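(* The stabilized automorphism groups $\mathrm{Aut}^{(\infty)}(\sigma_2)$ and $\mathrm{Aut}^{(\infty)}(\sigma_3)$ of the full $2$-shift and the full $3$-shift are not isomorphic as groups.
   Context: $(X_n,\sigma_n)$ denotes the full shift on $n$ symbols: $X_n=\mathcal{A}^{\mathbb{Z}}$ with $|\mathcal{A}|=n$ (product topology) and $\sigma_n$ the left shift. For a homeomorphism $T$ of a compact metric space $X$, $\mathrm{Aut}(T)$ is the group of homeomorphisms of $X$ commuting with $T$, and the stabilized automorphism group is $\mathrm{Aut}^{(\infty)}(T)=\bigcup_{k\ge1}\mathrm{Aut}(T^k)$, a subgroup of $\mathrm{Homeo}(X)$. *)

theory Defs
  imports "HOL-Analysis.Analysis" "HOL-Algebra.Bij"
begin

text \<open>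
  Self-maps of a space are represented as in \<^const>\<open>BijGroup\<close>: extensional functions,
  equal to \<^const>\<open>undefined\<close> outside \<^term>\<open>topspace X\<close>, so that equality of group elements is
  equality of maps on the space. The product \<open>f \<otimes> g\<close> is the composition ``\<open>f\<close> after \<open>g\<close>''.
\<close>

definition homeo_group :: "'a topology \<Rightarrow> ('a \<Rightarrow> 'a) monoid" where
  "homeo_group X =
     (BijGroup (topspace X))\<lparr>carrier := {f \<in> Bij (topspace X). homeomorphic_map X X f}\<rparr>"

text \<open>
  Below, \<open>T\<close> is meant to be a homeomorphism of \<open>X\<close>; it need not be extensional, since only
  its values on \<^term>\<open>topspace X\<close> matter.
\<close>

definition homeo_aut :: "'a topology \<Rightarrow> ('a \<Rightarrow> 'a) \<Rightarrow> ('a \<Rightarrow> 'a) set" where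
  "homeo_aut X T =
     {f \<in> carrier (homeo_group X). \<forall>x \<in> topspace X. f (T x) = T (f x)}"

definition stab_aut :: "'a topology \<Rightarrow> ('a \<Rightarrow> 'a) \<Rightarrow> ('a \<Rightarrow> 'a) set" where
  "stab_aut X T = (\<Union>k\<in>{1::nat..}. homeo_aut X (T ^^ k))"

definition stab_aut_group :: "'a topology \<Rightarrow> ('a \<Rightarrow> 'a) \<Rightarrow> ('a \<Rightarrow> 'a) monoid" where
  "stab_aut_group X T = (homeo_group X)\<lparr>carrier := stab_aut X T\<rparr>"

definition full_shift :: "'a set \<Rightarrow> (int \<Rightarrow> 'a) topology" where
  "full_shift A = product_topology (\<lambda>_. discrete_topology A) UNIV"

definition left_shift :: "(int \<Rightarrow> 'a) \<Rightarrow> int \<Rightarrow> 'a" where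
  "left_shift x = (\<lambda>i. x (i + 1))"


lemma mem_homeo_group_iff:
  "f \<in> carrier (homeo_group X) \<longleftrightarrow> f \<in> extensional (topspace X) \<and> homeomorphic_map X X f"
  using homeomorphic_imp_injective_map[of X X f] homeomorphic_imp_surjective_map[of X X f]
  unfolding homeo_group_def Bij_def bij_betw_def by simp blast

lemma mult_homeo_group:
  "f \<in> carrier (homeo_group X) \<Longrightarrow> g \<in> carrier (homeo_group X) \<Longrightarrow>
     f \<otimes>\<^bsub>homeo_group X\<^esub> g = compose (topspace X) f g"
  by (simp add: homeo_group_def BijGroup_def)

lemma subgroup_homeo_Bij: "subgroup (carrier (homeo_group X)) (BijGroup (topspace X))"
proof -
  interpret B: group "BijGroup (topspace X)" by (rule group_BijGroup)
  show ?thesis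
  proof (rule B.subgroupI)
    show "carrier (homeo_group X) \<subseteq> carrier (BijGroup (topspace X))"
      by (auto simp: homeo_group_def BijGroup_def)
    have "restrict id (topspace X) \<in> carrier (homeo_group X)"
      unfolding mem_homeo_group_iff
      using homeomorphic_map_eq[OF homeomorphic_map_id[THEN iffD2, OF refl, of X]] by auto
    then show "carrier (homeo_group X) \<noteq> {}" by blast
  next
    fix f assume f: "f \<in> carrier (homeo_group X)"
    then have fB: "f \<in> Bij (topspace X)" and h: "homeomorphic_map X X f"
      by (auto simp: homeo_group_def)
    obtain g where g: "homeomorphic_maps X X f g" using h homeomorphic_map_maps by blast
    have eq: "inv_into (topspace X) f x = g x" if "x \<in> topspace X" for x
    proof (rule inv_into_f_eq)
      show "inj_on f (topspace X)" using fB by (simp add: Bij_def bij_betw_def)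
      show "g x \<in> topspace X" "f (g x) = x"
        using g that by (auto simp: homeomorphic_maps_def dest: continuous_map_funspace)
    qed
    have "homeomorphic_map X X g" using g homeomorphic_maps_map by blast
    then have "homeomorphic_map X X (restrict (inv_into (topspace X) f) (topspace X))"
      by (rule homeomorphic_map_eq) (simp add: eq)
    then show "inv\<^bsub>BijGroup (topspace X)\<^esub> f \<in> carrier (homeo_group X)"
      using inv_BijGroup[OF fB] by (simp add: mem_homeo_group_iff)
  next
    fix f g assume fg: "f \<in> carrier (homeo_group X)" "g \<in> carrier (homeo_group X)"
    then have "homeomorphic_map X X (f \<circ> g)"
      by (auto simp: mem_homeo_group_iff intro: homeomorphic_map_compose)
    then have "homeomorphic_map X X (compose (topspace X) f g)"
      by (rule homeomorphic_map_eq) (simp add: compose_def)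
    then show "f \<otimes>\<^bsub>BijGroup (topspace X)\<^esub> g \<in> carrier (homeo_group X)"
      using mult_homeo_group[OF fg] mem_homeo_group_iff[of "compose (topspace X) f g" X]
      by (simp add: homeo_group_def)
  qed
qed

lemma group_homeo_group: "group (homeo_group X)"
proof -
  have "homeo_group X = (BijGroup (topspace X))\<lparr>carrier := carrier (homeo_group X)\<rparr>"
    by (simp add: homeo_group_def)
  then show ?thesis
    using group.subgroup_imp_group[OF group_BijGroup subgroup_homeo_Bij] by metis
qed

lemma funpow_topspace:
  "homeomorphic_map X X T \<Longrightarrow> x \<in> topspace X \<Longrightarrow> (T ^^ k) x \<in> topspace X"
  by (induction k) (auto dest: homeomorphic_imp_surjective_map)

lemma homeo_aut_funpow_mult:
  assumes T: "homeomorphic_map X X T" and f: "f \<in> homeo_aut X (T ^^ k)"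
  shows "f \<in> homeo_aut X (T ^^ (k * m))"
proof -
  have "f ((T ^^ (k * m)) x) = (T ^^ (k * m)) (f x)" if "x \<in> topspace X" for x
  proof (induction m)
    case (Suc m)
    have "f ((T ^^ (k * Suc m)) x) = f ((T ^^ k) ((T ^^ (k * m)) x))"
      by (simp add: funpow_add)
    also have "\<dots> = (T ^^ k) (f ((T ^^ (k * m)) x))"
      using f funpow_topspace[OF T that] by (simp add: homeo_aut_def)
    finally show ?case using Suc by (simp add: funpow_add)
  qed simp
  then show ?thesis using f by (simp add: homeo_aut_def)
qed

lemma subgroup_homeo_aut:
  assumes T: "\<And>x. x \<in> topspace X \<Longrightarrow> T x \<in> topspace X"
  shows "subgroup (homeo_aut X T) (homeo_group X)"
proof -
  interpret H: group "homeo_group X" by (rule group_homeo_group)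
  have one: "\<one>\<^bsub>homeo_group X\<^esub> = (\<lambda>x\<in>topspace X. x)"
    by (simp add: homeo_group_def BijGroup_def)
  have maps: "f x \<in> topspace X" if "f \<in> carrier (homeo_group X)" "x \<in> topspace X" for f x
    using that by (auto simp: mem_homeo_group_iff dest: homeomorphic_imp_surjective_map)
  show ?thesis
  proof (rule H.subgroupI)
    show "homeo_aut X T \<subseteq> carrier (homeo_group X)" by (auto simp: homeo_aut_def)
    have "\<one>\<^bsub>homeo_group X\<^esub> \<in> homeo_aut X T"
      using H.one_closed T by (simp add: homeo_aut_def) (simp add: one)
    then show "homeo_aut X T \<noteq> {}" by blast
  next
    fix f assume f: "f \<in> homeo_aut X T"
    then have fc: "f \<in> carrier (homeo_group X)" by (simp add: homeo_aut_def)
    let ?g = "inv\<^bsub>homeo_group X\<^esub> f"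
    have gc: "?g \<in> carrier (homeo_group X)" using fc by simp
    have gf: "?g (f x) = x" if "x \<in> topspace X" for x
      using fun_cong[OF H.l_inv[OF fc], of x] that mult_homeo_group[OF gc fc]
      by (simp add: one compose_def)
    have fg: "f (?g x) = x" if "x \<in> topspace X" for x
      using fun_cong[OF H.r_inv[OF fc], of x] that mult_homeo_group[OF fc gc]
      by (simp add: one compose_def)
    have "?g (T x) = T (?g x)" if x: "x \<in> topspace X" for x
    proof -
      have "f (T (?g x)) = T x"
        using f maps[OF gc x] fg[OF x] by (simp add: homeo_aut_def)
      then show ?thesis using gf[OF T[OF maps[OF gc x]]] by simp
    qed
    then show "?g \<in> homeo_aut X T" using gc by (simp add: homeo_aut_def)
  next
    fix f g assume "f \<in> homeo_aut X T" "g \<in> homeo_aut X T"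
    then show "f \<otimes>\<^bsub>homeo_group X\<^esub> g \<in> homeo_aut X T"
      using H.m_closed[of f g] mult_homeo_group[of f X g] T maps
      by (simp add: homeo_aut_def compose_def)
  qed
qed

lemma subgroup_stab_aut:
  assumes T: "homeomorphic_map X X T"
  shows "subgroup (stab_aut X T) (homeo_group X)"
proof -
  interpret H: group "homeo_group X" by (rule group_homeo_group)
  have sub: "subgroup (homeo_aut X (T ^^ k)) (homeo_group X)" for k
    by (rule subgroup_homeo_aut) (rule funpow_topspace[OF T])
  show ?thesis
  proof (rule H.subgroupI)
    show "stab_aut X T \<subseteq> carrier (homeo_group X)" by (auto simp: stab_aut_def homeo_aut_def)
    have "\<one>\<^bsub>homeo_group X\<^esub> \<in> stab_aut X T"
      unfolding stab_aut_def by (rule UN_I[of 1]) (use subgroup.one_closed[OF sub[of 1]] in auto)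
    then show "stab_aut X T \<noteq> {}" by blast
  next
    fix f assume "f \<in> stab_aut X T"
    then show "inv\<^bsub>homeo_group X\<^esub> f \<in> stab_aut X T"
      using subgroup.m_inv_closed[OF sub] by (auto simp: stab_aut_def)
  next
    fix f g assume "f \<in> stab_aut X T" "g \<in> stab_aut X T"
    then obtain j k where jk: "j \<ge> 1" "k \<ge> 1"
      and f: "f \<in> homeo_aut X (T ^^ j)" and g: "g \<in> homeo_aut X (T ^^ k)"
      by (auto simp: stab_aut_def)
    have "f \<in> homeo_aut X (T ^^ (j * k))" "g \<in> homeo_aut X (T ^^ (j * k))"
      using homeo_aut_funpow_mult[OF T f, of k] homeo_aut_funpow_mult[OF T g, of j]
      by (simp_all add: mult.commute)
    then have "f \<otimes>\<^bsub>homeo_group X\<^esub> g \<in> homeo_aut X (T ^^ (j * k))"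
      by (rule subgroup.m_closed[OF sub])
    moreover have "j * k \<ge> 1" using jk by simp
    ultimately show "f \<otimes>\<^bsub>homeo_group X\<^esub> g \<in> stab_aut X T" by (auto simp: stab_aut_def)
  qed
qed

lemma group_stab_aut_group:
  "homeomorphic_map X X T \<Longrightarrow> group (stab_aut_group X T)"
  unfolding stab_aut_group_def
  by (rule group.subgroup_imp_group[OF group_homeo_group subgroup_stab_aut])

lemma topspace_full_shift: "topspace (full_shift A) = {x. range x \<subseteq> A}"
  by (auto simp: full_shift_def PiE_def Pi_def)

lemma homeomorphic_map_left_shift:
  "homeomorphic_map (full_shift A) (full_shift A) left_shift"
proof -
  have c: "continuous_map (full_shift A) (full_shift A) (\<lambda>x i. x (i + c))" for c :: int
    unfolding full_shift_def continuous_map_componentwise_UNIV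
    by (auto intro: continuous_map_product_projection)
  have "homeomorphic_maps (full_shift A) (full_shift A) left_shift (\<lambda>x i. x (i + - 1))"
    unfolding homeomorphic_maps_def left_shift_def using c[of 1] c[of "-1"] by simp
  then show ?thesis using homeomorphic_map_maps by blast
qed

end

theory Submission
  imports Defs "HOL-Combinatorics.Permutations"
begin

text \<open>
  In the group of the 2-shift \<open>\<sigma>\<^sub>2\<close>, three elements already have centralizer
  consisting of powers of \<open>\<sigma>\<^sub>2\<close>: the shift, the partial shift moving only
  the coordinates outside \<open>3\<int>\<close>, and a Toffoli gate on each block of length 3. Commuting with
  them forces \<open>f x = g x 0\<close> to satisfy \<open>f (x + y z) = f x + f y f z\<close>, so that \<open>f\<close> is a continuous
  homomorphism of Boolean rings, i.e. a coordinate projection. An isomorphism with the group of the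
  3-shift \<open>\<sigma>\<^sub>3\<close> takes \<open>\<sigma>\<^sub>3\<close> to an element with a power commuting with any three
  given ones, so some \<open>\<sigma>\<^sub>3\<^sup>k\<close> corresponds to a power \<open>\<sigma>\<^sub>2\<^sup>i\<close>.

  Now let an injective homomorphism send \<open>\<sigma>\<^sup>c\<close> to \<open>\<tau>\<^sup>d\<close>, for full shifts \<open>\<sigma>\<close> on \<open>a\<close> symbols and
  \<open>\<tau>\<close> on \<open>b\<close> symbols. The permutations of
  the words of length \<open>L = c t\<close> form a symmetric group on \<open>a\<^sup>L\<close> points, whose image commutes with
  \<open>\<tau>\<close> to the power \<open>d t\<close> and hence acts on the \<open>b\<close> to the power \<open>d t\<close> points fixed by it. A
  nontrivial kernel of this action would contain all commutators; but a fixed pair of noncommuting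
  block permutations has images whose noncommutation is visible on periodic points for suitable \<open>t\<close>.
  So the action is faithful, and comparing factorials gives \<open>a\<^sup>c \<le> b\<^sup>d\<close>. Applied in both
  directions this yields \<open>2\<^sup>i = 3\<^sup>k\<close>.
\<close>

section \<open>Full shifts over a type\<close>

definition shift :: "int \<Rightarrow> (int \<Rightarrow> 'a) \<Rightarrow> int \<Rightarrow> 'a" where
  "shift c x = (\<lambda>i. x (i + c))"

text \<open>Continuity for the product of discrete topologies, in terms of coordinates. The window
  \<open>W\<close> may depend on the point \<open>x\<close>, so no compactness enters.\<close>

definition finitary :: "((int \<Rightarrow> 'a) \<Rightarrow> int \<Rightarrow> 'b) \<Rightarrow> bool" where
  "finitary F \<longleftrightarrow> (\<forall>x i. \<exists>W. finite W \<and> (\<forall>y. (\<forall>j\<in>W. y j = x j) \<longrightarrow> F y i = F x i))"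

abbreviation stab :: "((int \<Rightarrow> 'a) \<Rightarrow> int \<Rightarrow> 'a) set" where
  "stab \<equiv> stab_aut (full_shift UNIV) left_shift"

text \<open>HOL-Algebra reserves \<open>inv\<close> for the inverse in a group.\<close>

abbreviation fun_inv :: "('a \<Rightarrow> 'b) \<Rightarrow> 'b \<Rightarrow> 'a" where
  "fun_inv \<equiv> inv_into UNIV"

lemma topspace_full_shift_UNIV [simp]: "topspace (full_shift UNIV) = UNIV"
  by (simp add: topspace_full_shift)

lemma shift_shift [simp]: "shift c (shift d x) = shift (c + d) x"
  by (simp add: shift_def algebra_simps)

lemma shift_0 [simp]: "shift 0 = id"
  by (simp add: shift_def fun_eq_iff)

lemma left_shift_funpow: "left_shift ^^ k = shift (int k)"
  by (induction k) (auto simp: left_shift_def shift_def fun_eq_iff add.assoc)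

lemma finitaryI:
  assumes "\<And>i. \<exists>W. finite W \<and> (\<forall>x y. (\<forall>j\<in>W. y j = x j) \<longrightarrow> F y i = F x i)"
  shows "finitary F"
  unfolding finitary_def using assms by meson

lemma finitaryE:
  assumes "finitary F"
  obtains W where "finite W" "\<And>y. (\<And>j. j \<in> W \<Longrightarrow> y j = x j) \<Longrightarrow> F y i = F x i"
  using assms unfolding finitary_def by meson

lemma finitary_shift: "finitary (shift c)"
  by (rule finitaryI) (auto simp: shift_def intro!: exI[of _ "{i + c}" for i])

lemma continuous_map_full_shift_iff:
  "continuous_map (full_shift UNIV) (full_shift UNIV) F \<longleftrightarrow> finitary F"
proof
  assume c: "continuous_map (full_shift UNIV) (full_shift UNIV) F"
  show "finitary F"
    unfolding finitary_def
  proof (intro allI)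
    fix x i
    have "continuous_map (full_shift UNIV) (discrete_topology UNIV) (\<lambda>x. F x i)"
      using c unfolding full_shift_def continuous_map_componentwise_UNIV by blast
    then have "openin (full_shift UNIV) {y \<in> topspace (full_shift UNIV). F y i \<in> {F x i}}"
      by (rule openin_continuous_map_preimage) simp
    then have "openin (full_shift UNIV) {y. F y i = F x i}"
      by simp
    then obtain U where U: "finite {j. U j \<noteq> UNIV}" "x \<in> Pi\<^sub>E UNIV U" "Pi\<^sub>E UNIV U \<subseteq> {y. F y i = F x i}"
      unfolding full_shift_def openin_product_topology_alt by auto
    have "F y i = F x i" if "\<forall>j\<in>{j. U j \<noteq> UNIV}. y j = x j" for y
    proof -
      have "y j \<in> U j" for j using that U(2) by (cases "U j = UNIV") (auto simp: PiE_iff)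
      then show ?thesis using U(3) by (auto simp: PiE_iff)
    qed
    then show "\<exists>W. finite W \<and> (\<forall>y. (\<forall>j\<in>W. y j = x j) \<longrightarrow> F y i = F x i)"
      using U(1) by blast
  qed
next
  assume f: "finitary F"
  have "openin (full_shift UNIV) {x. F x i \<in> V}" for i V
    unfolding full_shift_def openin_product_topology_alt
  proof (intro ballI)
    fix x assume x: "x \<in> {x. F x i \<in> V}"
    obtain W where W: "finite W" "\<And>y. (\<And>j. j \<in> W \<Longrightarrow> y j = x j) \<Longrightarrow> F y i = F x i"
      using finitaryE[OF f] by metis
    let ?U = "\<lambda>j. if j \<in> W then {x j} else UNIV"
    have "finite {j \<in> UNIV. ?U j \<noteq> topspace (discrete_topology UNIV)}"
      by (rule finite_subset[OF _ W(1)]) auto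
    moreover have "Pi\<^sub>E UNIV ?U \<subseteq> {x. F x i \<in> V}"
    proof
      fix y assume "y \<in> Pi\<^sub>E UNIV ?U"
      then have "y j \<in> ?U j" for j by (simp only: PiE_iff) blast
      then have "y j = x j" if "j \<in> W" for j
        using that by (metis (full_types) singletonD)
      then have "F y i = F x i" by (rule W(2))
      then show "y \<in> {x. F x i \<in> V}" using x by simp
    qed
    ultimately show "\<exists>U. finite {j \<in> UNIV. U j \<noteq> topspace (discrete_topology UNIV)} \<and>
        (\<forall>i\<in>UNIV. openin (discrete_topology UNIV) (U i)) \<and> x \<in> Pi\<^sub>E UNIV U \<and>
        Pi\<^sub>E UNIV U \<subseteq> {x. F x i \<in> V}"
      by (intro exI[of _ ?U]) auto
  qed
  then have "continuous_map (full_shift UNIV) (discrete_topology UNIV) (\<lambda>x. F x i)" for i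
    by (auto simp: continuous_map_def)
  then show "continuous_map (full_shift UNIV) (full_shift UNIV) F"
    unfolding full_shift_def continuous_map_componentwise_UNIV by blast
qed

section \<open>Elements of the stabilized automorphism group as maps\<close>

lemma stabI:
  assumes "finitary f" "finitary f'" "f \<circ> f' = id" "f' \<circ> f = id"
    and "f \<circ> shift c = shift c \<circ> f" "c > 0"
  shows "f \<in> stab"
proof -
  have "homeomorphic_maps (full_shift UNIV) (full_shift UNIV) f f'"
    using assms by (auto simp: homeomorphic_maps_def continuous_map_full_shift_iff fun_eq_iff)
  then have "homeomorphic_map (full_shift UNIV) (full_shift UNIV) f"
    using homeomorphic_map_maps by blast
  then have "f \<in> homeo_aut (full_shift UNIV) (left_shift ^^ nat c)"
    using assms by (auto simp: homeo_aut_def mem_homeo_group_iff left_shift_funpow fun_eq_iff)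
  moreover have "nat c \<in> {1..}" using assms by auto
  ultimately show ?thesis unfolding stab_aut_def by blast
qed

lemma stabE:
  assumes "f \<in> stab"
  obtains k where "k > 0" "f \<circ> shift k = shift k \<circ> f"
proof -
  obtain k where k: "k \<in> {1::nat..}" "f \<in> homeo_aut (full_shift UNIV) (left_shift ^^ k)"
    using assms unfolding stab_aut_def by blast
  show ?thesis
    by (rule that[of "int k"]) (use k in \<open>auto simp: homeo_aut_def left_shift_funpow\<close>)
qed

lemma stab_homeo: "f \<in> stab \<Longrightarrow> homeomorphic_map (full_shift UNIV) (full_shift UNIV) f"
  by (auto simp: stab_aut_def homeo_aut_def mem_homeo_group_iff)

lemma stab_finitary: "f \<in> stab \<Longrightarrow> finitary f"
  using stab_homeo homeomorphic_imp_continuous_map continuous_map_full_shift_iff by blast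

lemma stab_bij: "f \<in> stab \<Longrightarrow> bij f"
  using stab_homeo[of f] homeomorphic_imp_injective_map[of _ _ f] homeomorphic_imp_surjective_map[of _ _ f]
  by (fastforce simp: bij_def)

lemma carrier_stab [simp]: "carrier (stab_aut_group (full_shift UNIV) left_shift) = stab"
  by (simp add: stab_aut_group_def)

lemma mult_stab:
  assumes "f \<in> stab" "g \<in> stab"
  shows "f \<otimes>\<^bsub>stab_aut_group (full_shift UNIV) left_shift\<^esub> g = f \<circ> g"
proof -
  have "f \<in> carrier (homeo_group (full_shift UNIV))" "g \<in> carrier (homeo_group (full_shift UNIV))"
    using assms by (auto simp: stab_aut_def homeo_aut_def)
  from mult_homeo_group[OF this] show ?thesis
    by (simp add: stab_aut_group_def compose_def fun_eq_iff)
qed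

lemma stab_comp: "f \<in> stab \<Longrightarrow> g \<in> stab \<Longrightarrow> f \<circ> g \<in> stab"
  using group.is_monoid[OF group_stab_aut_group[OF homeomorphic_map_left_shift]]
    monoid.m_closed mult_stab carrier_stab by metis

lemma shift_stab: "shift c \<in> stab"
  by (rule stabI[of _ "shift (- c)" 1]) (auto simp: finitary_shift fun_eq_iff add.commute)

lemma shift_inj:
  assumes "shift c = (shift d :: (int \<Rightarrow> 'a) \<Rightarrow> int \<Rightarrow> 'a)" "CARD('a) \<ge> 2"
  shows "c = d"
proof -
  obtain a b :: 'a where ab: "a \<noteq> b"
    using assms(2) card_2_iff' by (metis One_nat_def UNIV_I card_le_Suc0_iff_eq card.infinite
        not_less_eq_eq numeral_2_eq_2 le_zero_eq zero_neq_numeral)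
  have "shift c (\<lambda>i. if i = c then a else b) 0 = shift d (\<lambda>i. if i = c then a else b) 0"
    using assms(1) by simp
  then show ?thesis using ab by (auto simp: shift_def split: if_splits)
qed


section \<open>A finite set with centralizer generated by the shift\<close>

text \<open>Three tracks are interleaved by the residue mod 3; tracks 1 and 2 move by
  \<open>c\<close> blocks past track 0. The factor 3 keeps each coordinate in its track, so
  \<open>side_shift (- c)\<close> is the inverse.\<close>

definition side_shift :: "int \<Rightarrow> (int \<Rightarrow> bool) \<Rightarrow> int \<Rightarrow> bool" where
  "side_shift c x = (\<lambda>i. if i mod 3 = 0 then x i else x (i + 3 * c))"

text \<open>The controls lie in tracks 1 and 2 and the target in track 0, so the controls stay
  unchanged and the map is an involution.\<close>

definition toffoli :: "(int \<Rightarrow> bool) \<Rightarrow> int \<Rightarrow> bool" where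
  "toffoli x = (\<lambda>i. if i mod 3 = 0 then x i \<noteq> (x (i + 1) \<and> x (i + 2)) else x i)"

lemma side_shift_stab: "side_shift c \<in> stab"
proof (rule stabI[of _ "side_shift (- c)" 3])
  have "finitary (side_shift c)" for c
    by (rule finitaryI) (auto simp: side_shift_def intro!: exI[of _ "{i, i + 3 * c}" for i])
  then show "finitary (side_shift c)" "finitary (side_shift (- c))" by auto
qed (auto simp: side_shift_def shift_def fun_eq_iff algebra_simps)

lemma toffoli_stab: "toffoli \<in> stab"
proof (rule stabI[of _ toffoli 3])
  show "finitary toffoli"
  proof (rule finitaryI)
    fix i show "\<exists>W. finite W \<and> (\<forall>x y. (\<forall>j\<in>W. y j = x j) \<longrightarrow> toffoli y i = toffoli x i)"
      by (rule exI[of _ "{i, i + 1, i + 2}"]) (auto simp: toffoli_def)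
  qed
  then show "finitary toffoli" .
  have "i mod 3 = 0 \<Longrightarrow> (i + 1) mod 3 \<noteq> 0 \<and> (i + 2) mod 3 \<noteq> 0" for i :: int by presburger
  then show "toffoli \<circ> toffoli = id" by (auto simp: toffoli_def fun_eq_iff)
  then show "toffoli \<circ> toffoli = id" .
qed (auto simp: toffoli_def shift_def fun_eq_iff algebra_simps)

text \<open>\<open>f\<close> is the indicator of an ultrafilter on the integers. Continuity at the
  all-true point puts a finite set \<open>W\<close> into it, so it is principal.\<close>

lemma continuous_boolean_hom_is_coordinate:
  fixes f :: "(int \<Rightarrow> bool) \<Rightarrow> bool"
  assumes W: "finite W" "\<And>y. (\<And>j. j \<in> W \<Longrightarrow> y j) \<Longrightarrow> f y"
    and conj: "\<And>x y. f (\<lambda>i. x i \<and> y i) \<longleftrightarrow> f x \<and> f y"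
    and neg: "\<And>x. f (\<lambda>i. \<not> x i) \<longleftrightarrow> \<not> f x"
  shows "\<exists>i. \<forall>x. f x = x i"
proof -
  have disj: "f (\<lambda>i. x i \<or> y i) \<longleftrightarrow> f x \<or> f y" for x y
    using neg[of "\<lambda>i. \<not> x i \<and> \<not> y i"] conj[of "\<lambda>i. \<not> x i" "\<lambda>i. \<not> y i"] neg[of x] neg[of y]
    by auto
  have false: "\<not> f (\<lambda>i. False)"
    using neg[of "\<lambda>i. True"] W(2) by auto
  have single: "finite V \<Longrightarrow> f (\<lambda>i. i \<in> V) \<Longrightarrow> \<exists>i\<in>V. f (\<lambda>j. j = i)" for V
  proof (induction V rule: finite_induct)
    case (insert i V)
    then show ?case using disj[of "\<lambda>j. j = i" "\<lambda>j. j \<in> V"] by auto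
  qed (use false in simp)
  have "f (\<lambda>i. i \<in> W)" by (rule W(2))
  then obtain i where i: "f (\<lambda>j. j = i)" using single[OF W(1)] by auto
  have pos: "f x" if "x i" for x
  proof -
    have "(\<lambda>j. x j \<and> j = i) = (\<lambda>j. j = i)" using that by auto
    then show ?thesis using conj[of x "\<lambda>j. j = i"] i by simp
  qed
  have "f x = x i" for x
    using pos[of x] pos[of "\<lambda>i. \<not> x i"] neg[of x] by auto
  then show ?thesis by blast
qed

text \<open>Each commutation has one task: \<open>c1\<close> reduces \<open>g\<close> to the local
  rule \<open>f\<close>, \<open>c2\<close> makes \<open>f\<close> depend on track 0 only, and
  \<open>c3\<close> then becomes the functional equation \<open>key\<close>.\<close>

lemma centralizer_is_shift:
  assumes g: "g \<in> stab"
    and c1: "g \<circ> shift 1 = shift 1 \<circ> g"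
    and c2: "g \<circ> side_shift 1 = side_shift 1 \<circ> g"
    and c3: "g \<circ> toffoli = toffoli \<circ> g"
  shows "\<exists>i. g = shift i"
proof -
  define f where "f x = g x 0" for x
  have fin: "finitary g" using g by (rule stab_finitary)
  have sh: "g (shift (int n) x) = shift (int n) (g x)" for n x
  proof (induction n)
    case (Suc n)
    have "g (shift (int (Suc n)) x) = g (shift 1 (shift (int n) x))" by simp
    also have "\<dots> = shift 1 (g (shift (int n) x))" using c1 by (metis comp_apply)
    finally show ?case using Suc by simp
  qed simp
  have sh': "g (shift c x) = shift c (g x)" for c x
  proof (cases "c \<ge> 0")
    case True then show ?thesis using sh[of "nat c" x] by simp
  next
    case False
    have "g x = shift (- c) (g (shift c x))"
      using sh[of "nat (- c)" "shift c x"] False by simp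
    then show ?thesis by simp
  qed
  have gf: "g x i = f (shift i x)" for x i
    by (simp add: f_def sh') (simp add: shift_def)
  have side: "f (side_shift (int n) x) = f x" for n x
  proof (induction n)
    case (Suc n)
    have "side_shift (int (Suc n)) x = side_shift 1 (side_shift (int n) x)"
      by (auto simp: side_shift_def fun_eq_iff algebra_simps)
    then have "g (side_shift (int (Suc n)) x) = side_shift 1 (g (side_shift (int n) x))"
      using c2 by (metis comp_apply)
    then show ?case using Suc by (simp add: f_def side_shift_def)
  qed (simp add: side_shift_def)
  \<comment> \<open>A point agreeing with \<open>x\<close> near 0 and with \<open>y\<close> far away links the two values, since
      \<open>f\<close> does not change when the coordinates outside \<open>3\<int>\<close> are shifted.\<close>
  have dep: "f x = f y" if "\<And>i. i mod 3 = 0 \<Longrightarrow> x i = y i" for x y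
  proof -
    obtain V where V: "finite V" "\<And>z. (\<And>j. j \<in> V \<Longrightarrow> z j = x j) \<Longrightarrow> g z 0 = g x 0"
      using finitaryE[OF fin] by metis
    obtain W where W: "finite W" "\<And>z. (\<And>j. j \<in> W \<Longrightarrow> z j = y j) \<Longrightarrow> g z 0 = g y 0"
      using finitaryE[OF fin] by metis
    obtain M where M: "\<And>j. j \<in> V \<union> W \<Longrightarrow> \<bar>j\<bar> \<le> M"
      using V(1) W(1) bdd_above_finite[of "abs ` (V \<union> W)"] by (auto simp: bdd_above_def)
    \<comment> \<open>\<open>n\<close> is so large that \<open>W\<close> moved by
      \<open>3 * int n\<close> misses \<open>V\<close>. There, off track 0, \<open>z\<close> carries
      a translated copy of \<open>y\<close>, which \<open>side_shift\<close> brings back to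
      \<open>W\<close>.\<close>
    define n where "n = nat (2 * \<bar>M\<bar> + 1)"
    define z where "z = (\<lambda>i. if i \<in> V \<or> i mod 3 = 0 then x i else y (i - 3 * int n))"
    have "f z = f x" unfolding f_def by (rule V(2)) (simp add: z_def)
    moreover have "f (side_shift (int n) z) = f y"
      unfolding f_def
    proof (rule W(2))
      fix j assume j: "j \<in> W"
      have "j + 3 * int n \<notin> V" using M[of j] M[of "j + 3 * int n"] j unfolding n_def by auto
      then show "side_shift (int n) z j = y j"
        using that[of j] by (auto simp: side_shift_def z_def)
    qed
    ultimately show ?thesis using side by metis
  qed
  have key: "f (\<lambda>i. x i \<noteq> (y i \<and> z i)) \<longleftrightarrow> f x \<noteq> (f y \<and> f z)" for x y z
  proof -
    \<comment> \<open>Tracks 1 and 2 carry \<open>y\<close> and \<open>z\<close> delayed by 1 and 2,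
      so the gate at a multiple \<open>i\<close> of 3 reads \<open>x i\<close>, \<open>y i\<close>
      and \<open>z i\<close>. Other values do not matter, by \<open>dep\<close>.\<close>
    define w where "w = (\<lambda>i. if i mod 3 = 0 then x i else if i mod 3 = 1 then y (i - 1) else z (i - 2))"
    have "f (\<lambda>i. x i \<noteq> (y i \<and> z i)) = f (toffoli w)"
    proof (rule dep)
      fix i :: int assume i: "i mod 3 = 0"
      then have "(i + 1) mod 3 = 1" "(i + 2) mod 3 = 2" by presburger+
      with i show "(x i \<noteq> (y i \<and> z i)) = toffoli w i" by (simp add: toffoli_def w_def)
    qed
    also have "\<dots> = toffoli (g w) 0" using c3 unfolding f_def by (metis comp_apply)
    also have "\<dots> = (f w \<noteq> (f (shift 1 w) \<and> f (shift 2 w)))"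
      by (simp add: toffoli_def gf)
    also have "f w = f x" by (rule dep) (simp add: w_def)
    also have "f (shift 1 w) = f y"
    proof (rule dep)
      fix i :: int assume "i mod 3 = 0"
      then have "(i + 1) mod 3 = 1" by presburger
      then show "shift 1 w i = y i" by (simp add: shift_def w_def)
    qed
    also have "f (shift 2 w) = f z"
    proof (rule dep)
      fix i :: int assume "i mod 3 = 0"
      then have "(i + 2) mod 3 = 2" by presburger
      then show "shift 2 w i = z i" by (simp add: shift_def w_def)
    qed
    finally show ?thesis .
  qed
  have nonconst: "\<exists>x. f x = b" for b
  proof -
    obtain x where "g x = (\<lambda>_. b)" using stab_bij[OF g] by (metis bij_pointE)
    then have "f x = b" by (simp add: f_def)
    then show ?thesis by blast
  qed
  \<comment> \<open>Otherwise \<open>key\<close> with first argument false and third argument true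
    makes \<open>f\<close> constant, contrary to the surjectivity of \<open>g\<close>.\<close>
  have one: "f (\<lambda>_. True)"
  proof (rule ccontr)
    assume "\<not> f (\<lambda>_. True)"
    then have "f y = f (\<lambda>_. False)" for y
      using key[of "\<lambda>_. False" y "\<lambda>_. True"] by simp
    then show False using nonconst[of True] nonconst[of False] by metis
  qed
  have zero: "\<not> f (\<lambda>_. False)"
    using key[of "\<lambda>_. True" "\<lambda>_. True" "\<lambda>_. True"] one by simp
  have neg: "f (\<lambda>i. \<not> x i) \<longleftrightarrow> \<not> f x" for x
    using key[of x "\<lambda>_. True" "\<lambda>_. True"] one by simp
  have conj: "f (\<lambda>i. x i \<and> y i) \<longleftrightarrow> f x \<and> f y" for x y
    using key[of "\<lambda>_. False" x y] zero by simp
  obtain W where W: "finite W" "\<And>y. (\<And>j. j \<in> W \<Longrightarrow> y j = True) \<Longrightarrow> g y 0 = g (\<lambda>_. True) 0"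
    using finitaryE[OF fin, where x = "\<lambda>_. True"] by metis
  have nbhd: "f y" if "\<And>j. j \<in> W \<Longrightarrow> y j" for y
    using W(2)[of y] that one unfolding f_def by simp
  obtain i where "\<And>x. f x = x i"
    using continuous_boolean_hom_is_coordinate[of W f, OF W(1) nbhd conj neg] by blast
  then have "g x j = shift i x j" for x j by (simp add: gf shift_def add.commute)
  then show ?thesis by blast
qed


section \<open>Permutations of blocks\<close>

definition per :: "int \<Rightarrow> (int \<Rightarrow> 'a) set" where
  "per L = {x. shift L x = x}"

text \<open>A word of length \<open>L\<close> is encoded by its \<open>L\<close>-periodic extension, so that a permutation of words
  is recovered from the action of its block map on \<open>per L\<close>.\<close>

definition block_map :: "int \<Rightarrow> ((int \<Rightarrow> 'a) \<Rightarrow> int \<Rightarrow> 'a) \<Rightarrow> (int \<Rightarrow> 'a) \<Rightarrow> int \<Rightarrow> 'a" where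
  "block_map L \<pi> x = (\<lambda>i. \<pi> (\<lambda>j. x (i - i mod L + j mod L)) i)"

section \<open>Periodic points and their number\<close>

lemma per_mod:
  assumes "x \<in> per L"
  shows "x (i mod L) = x i"
proof -
  have nat: "x (i + int n * L) = x i" for n i
  proof (induction n)
    case (Suc n)
    have "x (i + int (Suc n) * L) = shift L x (i + int n * L)" by (simp add: shift_def algebra_simps)
    then show ?case using Suc assms by (simp add: per_def)
  qed simp
  have "x (i + k * L) = x i" for k i
  proof (cases "k \<ge> 0")
    case True then show ?thesis using nat[of i "nat k"] by simp
  next
    case False then show ?thesis using nat[of "i + k * L" "nat (- k)"] by simp
  qed
  then show ?thesis by (metis mod_div_mult_eq)
qed

lemma per_cong: "x \<in> per L \<Longrightarrow> i mod L = j mod L \<Longrightarrow> x i = x j"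
  using per_mod by metis

lemma perI: "(\<And>i. x (i + L) = x i) \<Longrightarrow> x \<in> per L"
  by (simp add: per_def shift_def fun_eq_iff)

lemma per_uminus: "per (- L) = per L"
proof -
  have "shift (- L) x = x \<longleftrightarrow> shift L x = x" for x :: "int \<Rightarrow> 'a"
    by (metis add.left_inverse add.right_inverse id_apply shift_0 shift_shift)
  then show ?thesis by (simp add: per_def)
qed

lemma per_abs: "per \<bar>L\<bar> = per L"
  by (cases "L \<ge> 0") (simp_all add: per_uminus)

text \<open>Every argument that \<open>block_map L \<pi>\<close> passes to \<open>\<pi>\<close> has
  this form, with \<open>q\<close> the start of a block; so only the values of \<open>\<pi>\<close>
  on \<open>per L\<close> matter.\<close>

lemma window_per: "(\<lambda>j. x (q + j mod L)) \<in> per L"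
  by (rule perI) simp

lemma bij_betw_per:
  assumes "L > 0"
  shows "bij_betw (\<lambda>x. restrict x {0..<L}) (per L :: (int \<Rightarrow> 'a) set) ({0..<L} \<rightarrow>\<^sub>E UNIV)"
proof (rule bij_betw_byWitness[where f' = "\<lambda>w i. w (i mod L)"])
  show "\<forall>x\<in>per L. (\<lambda>i. restrict x {0..<L} (i mod L)) = (x :: int \<Rightarrow> 'a)"
    using assms by (auto simp: fun_eq_iff per_mod)
  show "\<forall>w\<in>{0..<L} \<rightarrow>\<^sub>E (UNIV :: 'a set). restrict (\<lambda>i. w (i mod L)) {0..<L} = w"
    by (auto simp: fun_eq_iff PiE_iff extensional_def)
  show "(\<lambda>w i. w (i mod L)) ` ({0..<L} \<rightarrow>\<^sub>E (UNIV :: 'a set)) \<subseteq> per L"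
    by (auto intro: perI)
qed auto

lemma card_per:
  assumes "L > 0"
  shows "card (per L :: (int \<Rightarrow> 'a::finite) set) = CARD('a) ^ nat L"
  using bij_betw_same_card[OF bij_betw_per[OF assms, where 'a = 'a]] by (simp add: card_PiE)

lemma finite_per:
  assumes "L > 0"
  shows "finite (per L :: (int \<Rightarrow> 'a::finite) set)"
  by (rule card_ge_0_finite) (simp add: card_per[OF assms])

section \<open>Block maps as elements of the stabilized group\<close>

text \<open>All blocks of a periodic point spell the same word, so every window is \<open>x\<close>
  itself.\<close>

lemma block_map_per:
  assumes "x \<in> per L"
  shows "block_map L \<pi> x = \<pi> x"
proof -
  have "(\<lambda>j. x (i - i mod L + j mod L)) = x" for i
    by (rule ext, rule per_cong[OF assms]) (metis mod_add_left_eq mod_add_right_eq mod_diff_right_eq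
        mod_mod_trivial add_0 diff_self mod_0)
  then show ?thesis by (simp add: block_map_def)
qed

lemma block_map_id: "block_map L id = id"
  by (simp add: block_map_def fun_eq_iff)

lemma minus_mod_add_mod:
  fixes i j L :: int
  assumes "L > 0"
  shows "(i - i mod L + j mod L) mod L = j mod L" "(i - i mod L + j mod L) div L = i div L"
proof -
  have e: "i - i mod L + j mod L = j mod L + i div L * L"
    by (simp add: minus_mod_eq_div_mult)
  show "(i - i mod L + j mod L) mod L = j mod L" "(i - i mod L + j mod L) div L = i div L"
    unfolding e using assms by simp_all
qed

text \<open>Since \<open>\<rho>\<close> preserves \<open>per L\<close>, the word that
  \<open>block_map L \<rho>\<close> writes on a block has as its periodic extension the value of
  \<open>\<rho>\<close> at the old window, and this is what \<open>\<pi>\<close> reads.\<close>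

lemma block_map_comp:
  assumes "L > 0" "\<rho> permutes per L"
  shows "block_map L (\<pi> \<circ> \<rho>) = block_map L \<pi> \<circ> block_map L \<rho>"
proof (intro ext)
  fix x :: "int \<Rightarrow> 'a" and i
  let ?q = "i - i mod L"
  let ?w = "\<lambda>j. x (?q + j mod L)"
  have "block_map L \<rho> x (?q + j mod L) = \<rho> ?w j" for j
  proof -
    have "?q + j mod L - (?q + j mod L) mod L = ?q"
      using minus_mod_add_mod[OF assms(1)] by simp
    then have "block_map L \<rho> x (?q + j mod L) = \<rho> ?w (?q + j mod L)"
      by (simp add: block_map_def)
    also have "\<dots> = \<rho> ?w j"
    proof (rule per_cong)
      show "\<rho> ?w \<in> per L" using window_per permutes_in_image[OF assms(2)] by blast
    qed (rule minus_mod_add_mod[OF assms(1)])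
    finally show ?thesis .
  qed
  then show "block_map L (\<pi> \<circ> \<rho>) x i = (block_map L \<pi> \<circ> block_map L \<rho>) x i"
    by (simp add: block_map_def)
qed

lemma block_map_shift:
  assumes "L > 0" "\<pi> permutes per L"
  shows "block_map L \<pi> \<circ> shift L = shift L \<circ> block_map L \<pi>"
proof (intro ext)
  fix x :: "int \<Rightarrow> 'a" and i
  let ?w = "\<lambda>j. x (i + L - i mod L + j mod L)"
  have "?w \<in> per L" by (rule window_per)
  then have "\<pi> ?w \<in> per L" using permutes_in_image[OF assms(2)] by blast
  then have "\<pi> ?w i = \<pi> ?w (i + L)" by (rule per_cong) simp
  then show "(block_map L \<pi> \<circ> shift L) x i = (shift L \<circ> block_map L \<pi>) x i"
    by (simp add: block_map_def shift_def algebra_simps)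
qed

lemma finitary_block_map:
  assumes "L > 0"
  shows "finitary (block_map L \<pi>)"
proof (rule finitaryI)
  fix i
  show "\<exists>W. finite W \<and> (\<forall>x y. (\<forall>j\<in>W. y j = x j) \<longrightarrow> block_map L \<pi> y i = block_map L \<pi> x i)"
  proof (intro exI conjI allI impI)
    show "finite {i - i mod L..<i - i mod L + L}" by simp
    fix x y :: "int \<Rightarrow> 'a" assume *: "\<forall>j\<in>{i - i mod L..<i - i mod L + L}. y j = x j"
    have "y (i - i mod L + j mod L) = x (i - i mod L + j mod L)" for j
      by (rule *[rule_format]) (use assms in simp)
    then show "block_map L \<pi> y i = block_map L \<pi> x i" by (simp add: block_map_def)
  qed
qed

lemma block_map_stab:
  assumes "L > 0" "\<pi> permutes per L"
  shows "block_map L \<pi> \<in> stab"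
proof (rule stabI[of _ "block_map L (fun_inv \<pi>)" L])
  note inv = permutes_inv[OF assms(2)]
  show "block_map L \<pi> \<circ> block_map L (fun_inv \<pi>) = id" "block_map L (fun_inv \<pi>) \<circ> block_map L \<pi> = id"
    using block_map_comp[OF assms(1) inv, of \<pi>] block_map_comp[OF assms(1,2), of "fun_inv \<pi>"]
      permutes_inv_o[OF assms(2)] block_map_id by metis+
qed (use assms in \<open>auto simp: finitary_block_map block_map_shift\<close>)

section \<open>Restriction to periodic points and change of block length\<close>

lemma per_invariant:
  assumes "f \<circ> shift L = shift L \<circ> f" "x \<in> per L"
  shows "f x \<in> per L"
  using fun_cong[OF assms(1), of x] assms(2) by (simp add: per_def)

text \<open>If \<open>f x\<close> is periodic then \<open>f (shift L x) = f x\<close>, so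
  \<open>x\<close> is periodic by injectivity; thus \<open>f\<close> maps \<open>per L\<close> onto
  itself. The identity outside is what \<open>permutes\<close> asks for.\<close>

lemma per_permutes:
  assumes "bij f" "f \<circ> shift L = shift L \<circ> f"
  shows "(\<lambda>x. if x \<in> per L then f x else x) permutes per L"
proof (rule bij_imp_permutes)
  have "bij_betw f (per L) (per L)"
    unfolding bij_betw_def
  proof
    show "inj_on f (per L)" using assms(1) by (meson bij_is_inj inj_on_subset subset_UNIV)
    show "f ` per L = per L"
    proof
      show "per L \<subseteq> f ` per L"
      proof
        fix y :: "int \<Rightarrow> 'a" assume y: "y \<in> per L"
        obtain x where x: "f x = y" using assms(1) by (metis bij_pointE)
        have "f (shift L x) = f x"
          using fun_cong[OF assms(2), of x] x y by (simp add: per_def)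
        then have "shift L x = x" using assms(1) by (metis bij_pointE)
        then show "y \<in> f ` per L" using x by (auto simp: per_def)
      qed
    qed (use per_invariant[OF assms(2)] in auto)
  qed
  then show "bij_betw (\<lambda>x. if x \<in> per L then f x else x) (per L) (per L)"
    by (subst bij_betw_cong[where g = f]) auto
qed auto

lemma shift_mult_commute:
  assumes "f \<circ> shift L = shift L \<circ> f"
  shows "f \<circ> shift (L * int n) = shift (L * int n) \<circ> f"
proof (induction n)
  case (Suc n)
  have s: "shift (L * int (Suc n)) = shift L \<circ> shift (L * int n)"
    by (simp add: fun_eq_iff algebra_simps)
  show ?case unfolding s using assms Suc by (metis comp_assoc)
qed simp

text \<open>A long block is a union of \<open>t\<close> short ones, so the same map is a block map
  for both lengths. This allows two block maps to be fixed first and the length to be chosen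
  later.\<close>

lemma block_map_refine:
  assumes "L > 0" "t > 0" "\<pi> permutes per L"
  defines "\<pi>' \<equiv> \<lambda>x. if x \<in> per (L * int t) then block_map L \<pi> x else x"
  shows "\<pi>' permutes per (L * int t)" "block_map (L * int t) \<pi>' = block_map L \<pi>"
proof -
  show "\<pi>' permutes per (L * int t)"
    unfolding \<pi>'_def
    by (rule per_permutes[OF stab_bij[OF block_map_stab[OF assms(1,3)]]
          shift_mult_commute[OF block_map_shift[OF assms(1,3)]]])
  show "block_map (L * int t) \<pi>' = block_map L \<pi>"
  proof (intro ext)
    fix x :: "int \<Rightarrow> 'a" and i
    let ?N = "L * int t"
    have N: "?N > 0" using assms by simp
    let ?y = "\<lambda>j. x (i - i mod ?N + j mod ?N)"
    have "?y (i - i mod L + j mod L) = x (i - i mod L + j mod L)" for j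
    proof -
      let ?r = "i - i mod L + j mod L"
      have "?r div ?N = i div ?N"
        using minus_mod_add_mod(2)[OF assms(1), of i j] assms by (simp add: zdiv_zmult2_eq)
      then have "i - i mod ?N + ?r mod ?N = ?r"
        by (metis diff_add_cancel minus_mod_eq_mult_div)
      then show ?thesis by (simp only:)
    qed
    then have "block_map L \<pi> ?y i = block_map L \<pi> x i" by (simp add: block_map_def)
    moreover have "block_map ?N \<pi>' x i = block_map L \<pi> ?y i"
      using window_per[of x _ ?N] by (simp add: block_map_def[of ?N] \<pi>'_def)
    ultimately show "block_map ?N \<pi>' x i = block_map L \<pi> x i" by simp
  qed
qed

text \<open>Density of periodic points. The bound 2 on \<open>t\<close> later guarantees enough
  words for the argument on symmetric groups.\<close>

lemma periodic_approximation:
  fixes x :: "int \<Rightarrow> 'a"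
  assumes "finite W" "d \<noteq> 0"
  shows "\<exists>t\<ge>2. \<exists>z \<in> per (d * int t). \<forall>j\<in>W. z j = x j"
proof -
  obtain M where M: "\<And>j. j \<in> W \<Longrightarrow> \<bar>j\<bar> \<le> M"
    using assms(1) bdd_above_finite[of "abs ` W"] by (auto simp: bdd_above_def)
  define t where "t = nat (\<bar>M\<bar> + 1)"
  define N where "N = \<bar>d\<bar> * int t"
  have N: "N > \<bar>M\<bar>"
  proof -
    have "int t * 1 \<le> int t * \<bar>d\<bar>" using assms(2) by (intro mult_left_mono) auto
    then have "int t \<le> N" by (simp add: N_def mult.commute)
    then show ?thesis by (simp add: t_def)
  qed
  \<comment> \<open>The segment of \<open>x\<close> over [-N, N) covers \<open>W\<close> and is
    repeated with period \<open>2 * N\<close>.\<close>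
  define z where "z = (\<lambda>i. x ((i + N) mod (2 * N) - N))"
  have "z \<in> per (2 * N)"
  proof (rule perI)
    fix i
    have "(i + 2 * N + N) mod (2 * N) = (i + N) mod (2 * N)"
      by (metis add.assoc add.commute mod_add_self2)
    then show "z (i + 2 * N) = z i" by (simp only: z_def)
  qed
  moreover have "2 * N = d * int (2 * t) \<or> 2 * N = - (d * int (2 * t))"
    by (auto simp: N_def abs_if)
  ultimately have "z \<in> per (d * int (2 * t))" using per_uminus by metis
  moreover have "z j = x j" if "j \<in> W" for j
  proof -
    have "(j + N) mod (2 * N) = j + N" using M[OF that] N by (intro mod_pos_pos_trivial) auto
    then show ?thesis by (simp add: z_def)
  qed
  moreover have "2 * t \<ge> 2" by (simp add: t_def)
  ultimately show ?thesis by blast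
qed


section \<open>Quotients of symmetric groups\<close>

text \<open>HOL-Analysis reserves \<open>transpose\<close> for matrices.\<close>

abbreviation swap :: "'a \<Rightarrow> 'a \<Rightarrow> 'a \<Rightarrow> 'a" where
  "swap \<equiv> Transposition.transpose"

text \<open>A nontrivial \<open>\<pi>\<close> in the kernel gives two distinct transpositions with a
  common point the same value. Conjugation spreads this to all transpositions, so
  \<open>\<theta>\<close> takes at most two values, and these commute. Arguing by equality of values
  lets \<open>m\<close> be any operation.\<close>

lemma hom_with_kernel_is_abelian:
  fixes \<theta> :: "('a \<Rightarrow> 'a) \<Rightarrow> 'b"
  assumes X: "finite X" "card X \<ge> 5"
    and hom: "\<And>\<alpha> \<beta>. \<alpha> permutes X \<Longrightarrow> \<beta> permutes X \<Longrightarrow> \<theta> (\<alpha> \<circ> \<beta>) = m (\<theta> \<alpha>) (\<theta> \<beta>)"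
    and \<pi>: "\<pi> permutes X" "\<pi> \<noteq> id" "\<theta> \<pi> = \<theta> id"
    and \<rho>: "\<rho>1 permutes X" "\<rho>2 permutes X"
  shows "\<theta> (\<rho>1 \<circ> \<rho>2) = \<theta> (\<rho>2 \<circ> \<rho>1)"
proof -
  have conj: "\<gamma> \<circ> swap a b \<circ> fun_inv \<gamma> = swap (\<gamma> a) (\<gamma> b)" if "\<gamma> permutes X" for \<gamma> a b
  proof -
    have "\<gamma> \<circ> swap a b = swap (\<gamma> a) (\<gamma> b) \<circ> \<gamma>"
      using permutes_inj[OF that] by (auto simp: fun_eq_iff Transposition.transpose_def inj_eq)
    then show ?thesis by (metis comp_assoc comp_id permutes_inv_o(1)[OF that])
  qed
  have tp: "swap a b permutes X" if "a \<in> X" "b \<in> X" for a b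
    using that by (rule permutes_swap_id)
  have conjeq: "\<theta> (swap (\<gamma> a) (\<gamma> b)) = \<theta> (swap (\<gamma> c) (\<gamma> d))"
    if "\<theta> (swap a b) = \<theta> (swap c d)" "\<gamma> permutes X" "a \<in> X" "b \<in> X" "c \<in> X" "d \<in> X" for \<gamma> a b c d
  proof -
    have "\<theta> (\<gamma> \<circ> swap a b \<circ> fun_inv \<gamma>) = \<theta> (\<gamma> \<circ> swap c d \<circ> fun_inv \<gamma>)"
      using that tp permutes_inv[OF that(2)] by (simp add: hom permutes_compose)
    then show ?thesis using conj that(2) by simp
  qed
  have \<pi>eq: "\<theta> (swap (\<pi> a) (\<pi> b)) = \<theta> (swap a b)" if "a \<in> X" "b \<in> X" for a b
  proof -
    have i: "fun_inv \<pi> permutes X" using \<pi>(1) by (rule permutes_inv)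
    have "\<theta> (\<pi> \<circ> swap a b \<circ> fun_inv \<pi>) = \<theta> (id \<circ> swap a b \<circ> fun_inv \<pi>)"
      using that tp i \<pi> by (simp only: hom permutes_compose permutes_id)
    also have "\<dots> = m (\<theta> (swap a b)) (\<theta> (fun_inv \<pi>))" using that tp i by (simp add: hom)
    also have "\<theta> (fun_inv \<pi>) = \<theta> id"
      using hom[OF \<pi>(1) i] hom[OF permutes_id i] \<pi>(3) permutes_inv_o(1)[OF \<pi>(1)] by simp
    also have "m (\<theta> (swap a b)) (\<theta> id) = \<theta> (swap a b)"
      using hom[OF tp[OF that] permutes_id] by simp
    finally show ?thesis by (simp only: conj[OF \<pi>(1)])
  qed
  have extra: "\<exists>e\<in>X. e \<notin> set F" if "length F \<le> 4" for F
  proof (rule ccontr)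
    assume "\<not> ?thesis"
    then have "card X \<le> card (set F)" by (intro card_mono) auto
    then show False using X(2) card_length[of F] that by simp
  qed
  obtain u v w where uvw: "u \<in> X" "v \<in> X" "w \<in> X" "u \<noteq> v" "u \<noteq> w" "v \<noteq> w"
    and eq: "\<theta> (swap u v) = \<theta> (swap u w)"
  proof -
    obtain a where a: "\<pi> a \<noteq> a" using \<pi>(2) by (auto simp: fun_eq_iff)
    have inX: "\<And>y. y \<in> X \<Longrightarrow> \<pi> y \<in> X" using \<pi>(1) by (simp add: permutes_in_image)
    have inj: "\<And>y z. \<pi> y = \<pi> z \<longleftrightarrow> y = z" using permutes_inj[OF \<pi>(1)] by (simp add: inj_eq)
    have aX: "a \<in> X" using a \<pi>(1) by (meson permutes_not_in)
    define b where "b = \<pi> a"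
    have b: "b \<in> X" "b \<noteq> a" using a aX inX by (auto simp: b_def)
    \<comment> \<open>The pairs (a, b) and (b, \<pi> b) share one point unless \<open>\<pi>\<close>
      exchanges \<open>a\<close> and \<open>b\<close>. In that case a third point \<open>c\<close>
      gives (b, \<pi> c) and (a, c), which share \<open>c\<close> if it is fixed.\<close>
    show ?thesis
    proof (cases "\<pi> b = a")
      case False
      have "\<pi> b \<noteq> b" using inj[of b a] b by (auto simp: b_def)
      then show ?thesis
        using that[of b a "\<pi> b"] \<pi>eq[OF aX b(1)] False aX b inX
        by (auto simp: b_def transpose_commute)
    next
      case True
      obtain c where c: "c \<in> X" "c \<notin> set [a, b]" using extra[of "[a, b]"] by auto
      have e: "\<pi> c \<in> X" "\<pi> c \<noteq> a" "\<pi> c \<noteq> b"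
        using inX c inj[of c b] inj[of c a] True by (auto simp: b_def)
      have ace: "\<theta> (swap b (\<pi> c)) = \<theta> (swap a c)" using \<pi>eq[OF aX c(1)] by (simp add: b_def)
      show ?thesis
      proof (cases "\<pi> c = c")
        case True
        then show ?thesis using that[of c b a] ace c b aX by (auto simp: transpose_commute)
      next
        case False
        \<comment> \<open>Now these pairs are disjoint. Exchanging \<open>\<pi> c\<close> with a
          fifth point \<open>f\<close> alters only the first, so (b, \<pi> c) and (b, f) have the
          same value.\<close>
        obtain f where f: "f \<in> X" "f \<notin> set [a, b, c, \<pi> c]" using extra[of "[a, b, c, \<pi> c]"] by auto
        have "\<theta> (swap b f) = \<theta> (swap a c)"
          using conjeq[OF ace tp[OF e(1) f(1)] b(1) e(1) aX c(1)] False f e b c aX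
          by (auto simp: Transposition.transpose_def)
        then show ?thesis using that[of b "\<pi> c" f] ace b e f by auto
      qed
    qed
  qed
  have share: "\<theta> (swap a b) = \<theta> (swap a c)"
    if abc: "a \<in> X" "b \<in> X" "c \<in> X" "a \<noteq> b" "a \<noteq> c" for a b c
  proof (cases "b = c")
    case False
    obtain \<gamma> where "\<gamma> permutes X" "\<gamma> u = a" "\<gamma> v = b" "\<gamma> w = c"
    proof -
      \<comment> \<open>Three transpositions place \<open>u\<close>, \<open>v\<close> and
        \<open>w\<close> in turn, each fixing the points already placed.\<close>
      define g1 where "g1 = swap u a"
      define g2 where "g2 = swap (g1 v) b"
      define g3 where "g3 = swap (g2 (g1 w)) c"
      have p1: "g1 permutes X" unfolding g1_def using uvw abc by (intro tp) auto
      have i1: "g1 y \<in> X" if "y \<in> X" for y using permutes_in_image[OF p1] that by simp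
      have p2: "g2 permutes X" unfolding g2_def using uvw abc i1 by (intro tp) auto
      have i2: "g2 y \<in> X" if "y \<in> X" for y using permutes_in_image[OF p2] that by simp
      have p3: "g3 permutes X" unfolding g3_def using uvw abc i1 i2 by (intro tp) auto
      have j1: "g1 y = g1 z \<longleftrightarrow> y = z" for y z using permutes_inj[OF p1] by (simp add: inj_eq)
      have j2: "g2 y = g2 z \<longleftrightarrow> y = z" for y z using permutes_inj[OF p2] by (simp add: inj_eq)
      have a1: "g1 u = a" by (simp add: g1_def)
      have "g1 v \<noteq> a" using j1[of v u] a1 uvw by auto
      then have a2: "g2 a = a" using abc by (simp add: g2_def Transposition.transpose_def)
      have b2: "g2 (g1 v) = b" by (simp add: g2_def)
      have wa: "g2 (g1 w) \<noteq> a" using j2[of "g1 w" "g1 u"] j1[of w u] a1 a2 uvw by auto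
      have wb: "g2 (g1 w) \<noteq> b" using j2[of "g1 w" "g1 v"] j1[of w v] b2 uvw by auto
      have "g3 a = a" "g3 b = b" "g3 (g2 (g1 w)) = c"
        using wa wb abc False by (auto simp: g3_def Transposition.transpose_def)
      then show ?thesis
        using that[of "g3 \<circ> (g2 \<circ> g1)"] a1 a2 b2 p1 p2 p3 by (simp add: permutes_compose)
    qed
    then show ?thesis using conjeq[OF eq, of \<gamma>] uvw by simp
  qed simp
  define s where "s = \<theta> (swap u v)"
  have all: "\<theta> (swap a b) = s" if "a \<in> X" "b \<in> X" "a \<noteq> b" for a b
  proof (cases "a = u")
    case True
    then show ?thesis using share[of u b v] that uvw unfolding s_def by simp
  next
    case False
    have "\<theta> (swap a b) = \<theta> (swap u a)"
      using share[of a b u] that False uvw by (simp add: transpose_commute)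
    also have "\<dots> = s" using share[of u a v] that False uvw unfolding s_def by simp
    finally show ?thesis .
  qed
  have idid: "m (\<theta> id) (\<theta> id) = \<theta> id" "m s (\<theta> id) = s" "m (\<theta> id) s = s" "m s s = \<theta> id"
    using hom[OF permutes_id permutes_id] hom[OF tp[OF uvw(1,2)] permutes_id]
      hom[OF permutes_id tp[OF uvw(1,2)]] hom[OF tp[OF uvw(1,2)] tp[OF uvw(1,2)]]
    by (simp_all add: s_def)
  \<comment> \<open>Every permutation is a product of transpositions; each contributes a factor
    \<open>s\<close>, and \<open>m s s = \<theta> id\<close>.\<close>
  have two: "\<theta> \<rho> = \<theta> id \<or> \<theta> \<rho> = s" if "\<rho> permutes X" for \<rho>
    using that X(1)
  proof (induction rule: permutes_induct)
    case (swap a b p)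
    have e: "\<theta> (swap a b \<circ> p) = m s (\<theta> p)"
      using hom[OF tp[OF swap.hyps(1,2)] swap.hyps(4)] all[OF swap.hyps(1-3)] by (simp only:)
    from swap.IH show ?case
      unfolding e by (elim disjE) (simp_all only: idid simp_thms)
  qed simp
  show ?thesis
    using hom[OF \<rho>] hom[OF \<rho>(2,1)] two[OF \<rho>(1)] two[OF \<rho>(2)] idid by auto
qed


section \<open>Growth of periodic points\<close>

lemma commute_shift_uminus:
  assumes "f \<circ> shift L = shift L \<circ> f"
  shows "f \<circ> shift (- L) = shift (- L) \<circ> f"
proof
  fix x
  have "shift L (f (shift (- L) x)) = f x"
    using fun_cong[OF assms, of "shift (- L) x"] by simp
  then have "shift (- L) (f x) = shift (- L) (shift L (f (shift (- L) x)))" by simp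
  then show "(f \<circ> shift (- L)) x = (shift (- L) \<circ> f) x" by simp
qed

text \<open>The two sides are exponentials of the entropies of the matched shift powers. They are
  compared through the orders of symmetric groups on periodic points.\<close>

lemma growth_le:
  fixes \<Phi> :: "((int \<Rightarrow> 'a::finite) \<Rightarrow> int \<Rightarrow> 'a) \<Rightarrow> (int \<Rightarrow> 'b::finite) \<Rightarrow> int \<Rightarrow> 'b"
  assumes card: "CARD('a) \<ge> 2"
    and maps: "\<And>f. f \<in> stab \<Longrightarrow> \<Phi> f \<in> stab"
    and hom: "\<And>f g. f \<in> stab \<Longrightarrow> g \<in> stab \<Longrightarrow> \<Phi> (f \<circ> g) = \<Phi> f \<circ> \<Phi> g"
    and inj: "inj_on \<Phi> stab"
    and sh: "\<Phi> (shift c) = shift d" and cd: "c \<noteq> 0" "d \<noteq> 0"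
  shows "CARD('a) ^ nat \<bar>c\<bar> \<le> CARD('b) ^ nat \<bar>d\<bar>"
proof -
  \<comment> \<open>The factor 2 yields at least four periodic words even for
    \<open>\<bar>c\<bar> = 1\<close>, hence three points for two noncommuting
    transpositions.\<close>
  define L0 where "L0 = 2 * \<bar>c\<bar>"
  have L0: "L0 \<ge> 2" "L0 > 0" using cd by (auto simp: L0_def)
  have big: "card (per L :: (int \<Rightarrow> 'a) set) \<ge> 2 ^ n" if "L \<ge> int n" "L > 0" for L n
  proof -
    have "(2::nat) ^ n \<le> 2 ^ nat L" using that by (intro power_increasing) auto
    also have "\<dots> \<le> CARD('a) ^ nat L" using card by (rule power_mono) simp
    finally show ?thesis using card_per[OF that(2), where 'a = 'a] by simp
  qed
  have "3 \<le> card (per L0 :: (int \<Rightarrow> 'a) set)" using big[of 2 L0] L0 by simp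
  then obtain S :: "(int \<Rightarrow> 'a) set" where "S \<subseteq> per L0" "card S = 3"
    using obtain_subset_with_card_n by metis
  then obtain u v w :: "int \<Rightarrow> 'a" where uvw: "u \<in> per L0" "v \<in> per L0" "w \<in> per L0" "u \<noteq> v" "v \<noteq> w" "u \<noteq> w"
    by (auto simp: card_3_iff)
  define \<rho>1 where "\<rho>1 = swap u v"
  define \<rho>2 where "\<rho>2 = swap u w"
  have \<rho>: "\<rho>1 permutes per L0" "\<rho>2 permutes per L0"
    unfolding \<rho>1_def \<rho>2_def using uvw by (auto intro: permutes_swap_id)
  define h1 where "h1 = block_map L0 \<rho>1"
  define h2 where "h2 = block_map L0 \<rho>2"
  have h: "h1 \<in> stab" "h2 \<in> stab"
    unfolding h1_def h2_def using block_map_stab L0(2) \<rho> by auto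
  have "h1 (h2 u) = w" "h2 (h1 u) = v"
    using uvw by (auto simp: h1_def h2_def block_map_per \<rho>1_def \<rho>2_def Transposition.transpose_def)
  then have "h1 \<circ> h2 \<noteq> h2 \<circ> h1" using uvw by (metis comp_apply)
  then have "\<Phi> (h1 \<circ> h2) \<noteq> \<Phi> (h2 \<circ> h1)"
    using inj h stab_comp by (metis inj_onD)
  then obtain y j where yj: "\<Phi> (h1 \<circ> h2) y j \<noteq> \<Phi> (h2 \<circ> h1) y j"
    by (auto simp: fun_eq_iff)
  have fin: "finitary (\<Phi> (h1 \<circ> h2))" "finitary (\<Phi> (h2 \<circ> h1))"
    using h by (auto intro!: stab_finitary maps stab_comp)
  obtain W1 where W1: "finite W1" "\<And>z. (\<And>j. j \<in> W1 \<Longrightarrow> z j = y j) \<Longrightarrow> \<Phi> (h1 \<circ> h2) z j = \<Phi> (h1 \<circ> h2) y j"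
    by (rule finitaryE[OF fin(1), of y j]) blast
  obtain W2 where W2: "finite W2" "\<And>z. (\<And>j. j \<in> W2 \<Longrightarrow> z j = y j) \<Longrightarrow> \<Phi> (h2 \<circ> h1) z j = \<Phi> (h2 \<circ> h1) y j"
    by (rule finitaryE[OF fin(2), of y j]) blast
  \<comment> \<open>The difference of the two images at \<open>j\<close> is decided by finitely many
    coordinates of \<open>y\<close>, so a periodic point detects it too.\<close>
  obtain t z where t: "t \<ge> 2" and z: "z \<in> per (2 * d * int t)" "\<forall>j\<in>W1 \<union> W2. z j = y j"
    using periodic_approximation[of "W1 \<union> W2" "2 * d" y] W1(1) W2(1) cd by auto
  have zj: "\<Phi> (h1 \<circ> h2) z j \<noteq> \<Phi> (h2 \<circ> h1) z j"
    using yj W1(2)[of z] W2(2)[of z] z(2) by simp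

  \<comment> \<open>\<open>L\<close> and \<open>N\<close> are \<open>\<bar>c\<bar>\<close> and
    \<open>d\<close> times the same factor \<open>2 * t\<close>, so \<open>\<Phi>\<close> takes a
    shift by \<open>L\<close>, up to sign, to \<open>shift N\<close>.\<close>
  define L where "L = L0 * int t"
  define N where "N = 2 * d * int t"
  have L: "L > 0" "L \<ge> 3" and N: "N \<noteq> 0"
  proof -
    have "2 * int t \<le> L" unfolding L_def using L0 by (intro mult_right_mono) auto
    then show "L > 0" "L \<ge> 3" using t by auto
  qed (use cd t in \<open>simp add: N_def\<close>)
  \<comment> \<open>Starting at \<open>Suc 0\<close> makes \<open>sh\<close> the base case and
    avoids computing \<open>\<Phi> id\<close>.\<close>
  have shift_mult: "\<Phi> (shift (c * int (Suc n))) = shift (d * int (Suc n))" for n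
  proof (induction n)
    case (Suc n)
    have e: "shift (k * int (Suc (Suc n))) = (shift k \<circ> shift (k * int (Suc n)) :: (int \<Rightarrow> 'c) \<Rightarrow> _)" for k
      by (simp add: fun_eq_iff algebra_simps)
    have "\<Phi> (shift c \<circ> shift (c * int (Suc n))) = \<Phi> (shift c) \<circ> \<Phi> (shift (c * int (Suc n)))"
      by (rule hom[OF shift_stab shift_stab])
    then show ?case unfolding e Suc sh .
  qed (simp add: sh)
  obtain n where n: "2 * t = Suc n" using t by (cases "2 * t") auto
  have shift_N: "\<Phi> (shift (c * int (2 * t))) = shift N"
    using shift_mult[of n, folded n] by (simp add: N_def algebra_simps)
  have stab: "block_map L \<pi> \<in> stab" if "\<pi> permutes per L" for \<pi> :: "(int \<Rightarrow> 'a) \<Rightarrow> _"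
    using block_map_stab L(1) that by blast
  have comm: "\<Phi> (block_map L \<pi>) \<circ> shift N = shift N \<circ> \<Phi> (block_map L \<pi>)"
    if "\<pi> permutes per L" for \<pi>
  proof -
    have "c * int (2 * t) = L \<or> c * int (2 * t) = - L"
      by (cases "c \<ge> 0") (simp_all add: L_def L0_def)
    then have "block_map L \<pi> \<circ> shift (c * int (2 * t)) = shift (c * int (2 * t)) \<circ> block_map L \<pi>"
      using block_map_shift[OF L(1) that] commute_shift_uminus[OF block_map_shift[OF L(1) that]]
      by (elim disjE) (simp_all only:)
    then show ?thesis
      using hom[OF stab[OF that] shift_stab[of "c * int (2 * t)"]]
        hom[OF shift_stab[of "c * int (2 * t)"] stab[OF that]] by (simp only: shift_N)
  qed
  \<comment> \<open>The action of block permutations on the finite set \<open>per N\<close>, which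
    their images preserve by \<open>comm\<close>.\<close>
  define \<theta> where "\<theta> \<pi> = (\<lambda>y. if y \<in> per N then \<Phi> (block_map L \<pi>) y else y)" for \<pi>
  have \<theta>_perm: "\<theta> \<pi> permutes per N" if "\<pi> permutes per L" for \<pi>
    unfolding \<theta>_def by (rule per_permutes[OF stab_bij[OF maps[OF stab[OF that]]] comm[OF that]])
  have \<theta>_hom: "\<theta> (\<alpha> \<circ> \<beta>) = \<theta> \<alpha> \<circ> \<theta> \<beta>" if "\<alpha> permutes per L" "\<beta> permutes per L" for \<alpha> \<beta>
    using per_invariant[OF comm[OF that(2)]] that
    by (auto simp: fun_eq_iff \<theta>_def block_map_comp L hom stab)
  have t0: "t > 0" using t by simp
  obtain \<rho>1' where \<rho>1': "\<rho>1' permutes per L" "block_map L \<rho>1' = h1"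
    unfolding L_def h1_def
    by (rule that[unfolded L_def h1_def, OF block_map_refine[OF L0(2) t0 \<rho>(1)]])
  obtain \<rho>2' where \<rho>2': "\<rho>2' permutes per L" "block_map L \<rho>2' = h2"
    unfolding L_def h2_def
    by (rule that[unfolded L_def h2_def, OF block_map_refine[OF L0(2) t0 \<rho>(2)]])
  note \<rho>' = \<rho>1'(1) \<rho>2'(1) and h' = \<rho>1'(2) \<rho>2'(2)
  have "\<theta> (\<rho>1' \<circ> \<rho>2') z j \<noteq> \<theta> (\<rho>2' \<circ> \<rho>1') z j"
    using z(1) zj \<rho>' h' by (simp add: \<theta>_def N_def block_map_comp L)
  then have noncomm: "\<theta> (\<rho>1' \<circ> \<rho>2') \<noteq> \<theta> (\<rho>2' \<circ> \<rho>1')" by metis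
  have fin_per: "finite (per L :: (int \<Rightarrow> 'a) set)" "card (per L :: (int \<Rightarrow> 'a) set) \<ge> 5"
    using finite_per[OF L(1)] big[of 3 L] L by auto
  \<comment> \<open>A nontrivial permutation acting trivially would make all images commute, against
    \<open>noncomm\<close>.\<close>
  have "inj_on \<theta> {\<pi>. \<pi> permutes per L}"
  proof (rule inj_onI)
    fix \<alpha> \<beta> assume "\<alpha> \<in> {\<pi>. \<pi> permutes per L}" "\<beta> \<in> {\<pi>. \<pi> permutes per L}" and eq: "\<theta> \<alpha> = \<theta> \<beta>"
    then have p: "\<alpha> permutes per L" "\<beta> permutes per L" by auto
    have i: "fun_inv \<beta> permutes per L" using p(2) by (rule permutes_inv)
    have "\<theta> (\<alpha> \<circ> fun_inv \<beta>) = \<theta> (\<beta> \<circ> fun_inv \<beta>)" using p i eq by (simp add: \<theta>_hom)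
    then have "\<theta> (\<alpha> \<circ> fun_inv \<beta>) = \<theta> id" using permutes_inv_o(1)[OF p(2)] by simp
    then have "\<alpha> \<circ> fun_inv \<beta> = id"
      using hom_with_kernel_is_abelian[of "per L" \<theta> "(\<circ>)", OF fin_per \<theta>_hom permutes_compose[OF i p(1)] _ _ \<rho>'] noncomm
      by blast
    then have "\<alpha> \<circ> (fun_inv \<beta> \<circ> \<beta>) = \<beta>" by (metis comp_assoc id_comp)
    then show "\<alpha> = \<beta>" using permutes_inv_o(2)[OF p(2)] by simp
  qed
  have card_N: "card (per N :: (int \<Rightarrow> 'b) set) = CARD('b) ^ nat \<bar>N\<bar>"
    and fin_N: "finite (per N :: (int \<Rightarrow> 'b) set)"
    using card_per[of "\<bar>N\<bar>", where 'a = 'b] finite_per[of "\<bar>N\<bar>", where 'a = 'b] N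
    by (simp_all add: per_abs)
  have "card {\<pi>. \<pi> permutes (per L :: (int \<Rightarrow> 'a) set)} \<le> card {\<pi>. \<pi> permutes (per N :: (int \<Rightarrow> 'b) set)}"
    by (rule card_inj_on_le[of \<theta>]) (use \<open>inj_on \<theta> _\<close> \<theta>_perm finite_permutations[OF fin_N] in auto)
  then have "(fact (card (per L :: (int \<Rightarrow> 'a) set)) :: nat) \<le> fact (card (per N :: (int \<Rightarrow> 'b) set))"
    using card_permutations[OF refl fin_per(1)] card_permutations[OF refl fin_N] by simp
  then have "card (per L :: (int \<Rightarrow> 'a) set) \<le> card (per N :: (int \<Rightarrow> 'b) set)"
    using fact_less_mono_nat[of "card (per N :: (int \<Rightarrow> 'b) set)" "card (per L :: (int \<Rightarrow> 'a) set)"] card_N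
    by (force simp: not_le[symmetric])
  then have "CARD('a) ^ nat L \<le> CARD('b) ^ nat \<bar>N\<bar>"
    using card_N card_per[OF L(1), where 'a = 'a] by simp
  moreover have "nat L = nat \<bar>c\<bar> * (2 * t)" "nat \<bar>N\<bar> = nat \<bar>d\<bar> * (2 * t)"
    by (simp_all add: L_def L0_def N_def abs_mult nat_mult_distrib)
  ultimately have "(CARD('a) ^ nat \<bar>c\<bar>) ^ (2 * t) \<le> (CARD('b) ^ nat \<bar>d\<bar>) ^ (2 * t)"
    by (simp only: power_mult)
  then show ?thesis using t by (simp add: power_mono_iff)
qed


section \<open>Change of alphabet\<close>

lemma stab_aut_conjugate:
  assumes hk: "homeomorphic_maps X Y h k" and T: "homeomorphic_map X X T"
    and conj: "\<And>x. x \<in> topspace X \<Longrightarrow> h (T x) = S (h x)"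
    and f: "f \<in> stab_aut X T"
  shows "(\<lambda>y\<in>topspace Y. h (f (k y))) \<in> stab_aut Y S"
proof -
  obtain n where n: "n \<in> {1::nat..}" "f \<in> homeo_aut X (T ^^ n)"
    using f by (auto simp: stab_aut_def)
  have fX: "homeomorphic_map X X f" and comm: "\<And>x. x \<in> topspace X \<Longrightarrow> f ((T ^^ n) x) = (T ^^ n) (f x)"
    using n(2) by (auto simp: homeo_aut_def mem_homeo_group_iff)
  have hX: "h x \<in> topspace Y" "k (h x) = x" if "x \<in> topspace X" for x
    using hk that by (auto simp: homeomorphic_maps_def dest: continuous_map_funspace)
  have kY: "k y \<in> topspace X" "h (k y) = y" if "y \<in> topspace Y" for y
    using hk that by (auto simp: homeomorphic_maps_def dest: continuous_map_funspace)
  have conj_n: "h ((T ^^ m) x) = (S ^^ m) (h x)" if "x \<in> topspace X" for m x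
    by (induction m) (use conj funpow_topspace[OF T that] in auto)
  have "homeomorphic_map Y Y (h \<circ> (f \<circ> k))"
    using hk fX homeomorphic_maps_map by (meson homeomorphic_map_compose)
  then have "homeomorphic_map Y Y (\<lambda>y\<in>topspace Y. h (f (k y)))"
    by (rule homeomorphic_map_eq) simp
  moreover have "h (f (k ((S ^^ n) y))) = (S ^^ n) (h (f (k y)))" "(S ^^ n) y \<in> topspace Y"
    if y: "y \<in> topspace Y" for y
  proof -
    have e: "(S ^^ n) y = h ((T ^^ n) (k y))" using conj_n[OF kY(1)[OF y]] kY(2)[OF y] by simp
    have t: "(T ^^ n) (k y) \<in> topspace X" using funpow_topspace[OF T kY(1)[OF y]] .
    show "(S ^^ n) y \<in> topspace Y" unfolding e using hX t by simp
    have "f (k y) \<in> topspace X" using funpow_topspace[OF fX kY(1)[OF y], of 1] by simp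
    then show "h (f (k ((S ^^ n) y))) = (S ^^ n) (h (f (k y)))"
      unfolding e using hX(2)[OF t] comm[OF kY(1)[OF y]] conj_n by simp
  qed
  ultimately have "(\<lambda>y\<in>topspace Y. h (f (k y))) \<in> homeo_aut Y (S ^^ n)"
    by (auto simp: homeo_aut_def mem_homeo_group_iff)
  then show ?thesis using n(1) unfolding stab_aut_def by blast
qed

text \<open>Transport of structure. It lets arbitrary alphabets be replaced by \<open>bool\<close>
  and \<open>bool option\<close>, whose shift spaces are all of \<open>UNIV\<close>, so that the
  product is plain composition.\<close>

lemma stab_aut_group_iso:
  assumes hk: "homeomorphic_maps X Y h k"
    and T: "homeomorphic_map X X T" and S: "homeomorphic_map Y Y S"
    and conj: "\<And>x. x \<in> topspace X \<Longrightarrow> h (T x) = S (h x)"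
  shows "stab_aut_group X T \<cong> stab_aut_group Y S"
proof -
  define F where "F f = (\<lambda>y\<in>topspace Y. h (f (k y)))" for f
  define G where "G f = (\<lambda>x\<in>topspace X. k (f (h x)))" for f
  have kh: "homeomorphic_maps Y X k h" using hk homeomorphic_maps_sym by blast
  have hX: "h x \<in> topspace Y" "k (h x) = x" if "x \<in> topspace X" for x
    using hk that by (auto simp: homeomorphic_maps_def dest: continuous_map_funspace)
  have kY: "k y \<in> topspace X" "h (k y) = y" if "y \<in> topspace Y" for y
    using hk that by (auto simp: homeomorphic_maps_def dest: continuous_map_funspace)
  have conj': "k (S y) = T (k y)" if "y \<in> topspace Y" for y
    using conj[OF kY(1)[OF that]] kY(2)[OF that] hX(2)[of "T (k y)"] funpow_topspace[OF T kY(1)[OF that], of 1]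
    by simp
  have FG: "F f \<in> stab_aut Y S" if "f \<in> stab_aut X T" for f
    unfolding F_def by (rule stab_aut_conjugate[OF hk T conj that])
  have GF: "G f \<in> stab_aut X T" if "f \<in> stab_aut Y S" for f
    unfolding G_def by (rule stab_aut_conjugate[OF kh S conj' that])
  have ext: "f \<in> extensional (topspace Z)" "f \<in> carrier (homeo_group Z)"
      "z \<in> topspace Z \<Longrightarrow> f z \<in> topspace Z"
    if "f \<in> stab_aut Z R" for f z R and Z :: "'c topology"
    using that funpow_topspace[of Z f z 1]
    by (auto simp: stab_aut_def homeo_aut_def mem_homeo_group_iff)
  have "G (F f) = f" if "f \<in> stab_aut X T" for f
  proof
    fix x show "G (F f) x = f x"
      using ext[OF that] hX kY by (cases "x \<in> topspace X") (auto simp: G_def F_def extensional_def)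
  qed
  moreover have "F (G f) = f" if "f \<in> stab_aut Y S" for f
  proof
    fix x show "F (G f) x = f x"
      using ext[OF that] hX kY by (cases "x \<in> topspace Y") (auto simp: G_def F_def extensional_def)
  qed
  ultimately have bij: "bij_betw F (stab_aut X T) (stab_aut Y S)"
    using FG GF by (intro bij_betw_byWitness[where f' = G]) auto
  have "F \<in> hom (stab_aut_group X T) (stab_aut_group Y S)"
  proof (rule homI)
    fix f g assume "f \<in> carrier (stab_aut_group X T)" "g \<in> carrier (stab_aut_group X T)"
    then have fg: "f \<in> stab_aut X T" "g \<in> stab_aut X T" by (auto simp: stab_aut_group_def)
    have "compose (topspace Y) (F f) (F g) = F (compose (topspace X) f g)"
      using ext(3)[OF fg(2)] hX kY by (auto simp: F_def compose_def fun_eq_iff)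
    then show "F (f \<otimes>\<^bsub>stab_aut_group X T\<^esub> g) = F f \<otimes>\<^bsub>stab_aut_group Y S\<^esub> F g"
      using mult_homeo_group[OF ext(2)[OF fg(1)] ext(2)[OF fg(2)]]
        mult_homeo_group[OF ext(2)[OF FG[OF fg(1)]] ext(2)[OF FG[OF fg(2)]]]
      by (simp add: stab_aut_group_def)
  qed (use FG in \<open>auto simp: stab_aut_group_def\<close>)
  with bij have "F \<in> iso (stab_aut_group X T) (stab_aut_group Y S)"
    by (simp add: iso_def stab_aut_group_def)
  then show ?thesis by (rule is_isoI)
qed

lemma continuous_map_letterwise:
  assumes "q \<in> C \<rightarrow> D"
  shows "continuous_map (full_shift C) (full_shift D) (\<lambda>x i. q (x i))"
  unfolding full_shift_def continuous_map_componentwise_UNIV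
proof
  fix i :: int
  have "continuous_map (product_topology (\<lambda>_. discrete_topology C) UNIV) (discrete_topology D)
      (q \<circ> (\<lambda>x. x i))"
    by (rule continuous_map_compose[OF continuous_map_product_projection]) (use assms in auto)
  then show "continuous_map (product_topology (\<lambda>_. discrete_topology C) UNIV) (discrete_topology D)
      (\<lambda>x. q (x i))" by (simp add: comp_def)
qed

lemma full_shift_iso:
  assumes "bij_betw e A B"
  shows "stab_aut_group (full_shift A) left_shift \<cong> stab_aut_group (full_shift B) left_shift"
proof (rule stab_aut_group_iso)
  let ?e' = "inv_into A e"
  have e: "e \<in> A \<rightarrow> B" "?e' \<in> B \<rightarrow> A" "\<And>a. a \<in> A \<Longrightarrow> ?e' (e a) = a" "\<And>b. b \<in> B \<Longrightarrow> e (?e' b) = b"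
    using assms bij_betw_inv_into_left[OF assms] bij_betw_inv_into_right[OF assms]
      bij_betw_inv_into[OF assms] by (auto simp: bij_betw_apply)
  show "homeomorphic_maps (full_shift A) (full_shift B) (\<lambda>x i. e (x i)) (\<lambda>x i. ?e' (x i))"
    unfolding homeomorphic_maps_def
    using continuous_map_letterwise[OF e(1)] continuous_map_letterwise[OF e(2)] e(3,4)
    by (auto simp: topspace_full_shift subset_iff)
qed (auto simp: homeomorphic_map_left_shift, simp add: left_shift_def)


section \<open>The 2-shift and the 3-shift\<close>

lemma not_iso_bool_option:
  "\<not> stab_aut_group (full_shift (UNIV :: bool set)) left_shift \<cong>
      stab_aut_group (full_shift (UNIV :: bool option set)) left_shift"
  (is "\<not> ?G2 \<cong> ?G3")
proof
  assume "?G2 \<cong> ?G3"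
  then obtain \<Phi> where \<Phi>: "\<Phi> \<in> iso ?G2 ?G3" by (auto simp: is_iso_def)
  then have bij: "bij_betw \<Phi> stab stab" by (simp add: iso_def)
  have maps: "\<Phi> f \<in> stab" if "f \<in> stab" for f using bij that by (rule bij_betw_apply)
  have hom: "\<Phi> (f \<circ> g) = \<Phi> f \<circ> \<Phi> g" if "f \<in> stab" "g \<in> stab" for f g
    using \<Phi> that maps hom_mult[of \<Phi> ?G2 ?G3 f g] by (simp add: iso_def mult_stab)
  define \<Psi> where "\<Psi> = inv_into stab \<Phi>"
  have bij': "bij_betw \<Psi> stab stab" unfolding \<Psi>_def using bij by (rule bij_betw_inv_into)
  have maps': "\<Psi> f \<in> stab" if "f \<in> stab" for f using bij' that by (rule bij_betw_apply)
  have \<Psi>\<Phi>: "\<Psi> (\<Phi> f) = f" if "f \<in> stab" for f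
    unfolding \<Psi>_def using bij that by (rule bij_betw_inv_into_left)
  have \<Phi>\<Psi>: "\<Phi> (\<Psi> f) = f" if "f \<in> stab" for f
    unfolding \<Psi>_def using bij that by (rule bij_betw_inv_into_right)
  have hom': "\<Psi> (f \<circ> g) = \<Psi> f \<circ> \<Psi> g" if "f \<in> stab" "g \<in> stab" for f g
    using hom[OF maps'[OF that(1)] maps'[OF that(2)]] that \<Phi>\<Psi> \<Psi>\<Phi> maps' stab_comp by metis
  have card3: "CARD(bool option) = 3" by (simp add: UNIV_option_conv card_image)
  obtain k1 where k1: "k1 > 0" "\<Phi> (shift 1) \<circ> shift k1 = shift k1 \<circ> \<Phi> (shift 1)"
    using stabE[OF maps[OF shift_stab]] by metis
  obtain k2 where k2: "k2 > 0" "\<Phi> (side_shift 1) \<circ> shift k2 = shift k2 \<circ> \<Phi> (side_shift 1)"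
    using stabE[OF maps[OF side_shift_stab]] by metis
  obtain k3 where k3: "k3 > 0" "\<Phi> toffoli \<circ> shift k3 = shift k3 \<circ> \<Phi> toffoli"
    using stabE[OF maps[OF toffoli_stab]] by metis
  \<comment> \<open>A common multiple: \<open>shift k\<close> commutes with the images of all three
    elements, so its preimage \<open>g\<close> commutes with the elements themselves.\<close>
  define k where "k = k1 * k2 * k3"
  have k: "k > 0" "k = k1 * int (nat (k2 * k3))" "k = k2 * int (nat (k1 * k3))" "k = k3 * int (nat (k1 * k2))"
  proof -
    have "k1 * k2 > 0" "k1 * k3 > 0" "k2 * k3 > 0" using k1(1) k2(1) k3(1) by simp_all
    then have "int (nat (k1 * k2)) = k1 * k2" "int (nat (k1 * k3)) = k1 * k3" "int (nat (k2 * k3)) = k2 * k3"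
      by simp_all
    then show "k = k1 * int (nat (k2 * k3))" "k = k2 * int (nat (k1 * k3))" "k = k3 * int (nat (k1 * k2))"
      by (simp_all only: k_def mult_ac)
  qed (use k1(1) k2(1) k3(1) in \<open>simp add: k_def\<close>)
  define g where "g = \<Psi> (shift k)"
  have g: "g \<in> stab" unfolding g_def by (rule maps'[OF shift_stab])
  have comm: "g \<circ> f = f \<circ> g" if "f \<in> stab" "\<Phi> f \<circ> shift k = shift k \<circ> \<Phi> f" for f
    using hom'[OF maps[OF that(1)] shift_stab, of k] hom'[OF shift_stab maps[OF that(1)], of k]
      that \<Psi>\<Phi> by (simp add: g_def)
  have "\<exists>i. g = shift i"
  proof (rule centralizer_is_shift[OF g])
    show "g \<circ> shift 1 = shift 1 \<circ> g"
      using comm[OF shift_stab] shift_mult_commute[OF k1(2)] k(2) by metis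
    show "g \<circ> side_shift 1 = side_shift 1 \<circ> g"
      using comm[OF side_shift_stab] shift_mult_commute[OF k2(2)] k(3) by metis
    show "g \<circ> toffoli = toffoli \<circ> g"
      using comm[OF toffoli_stab] shift_mult_commute[OF k3(2)] k(4) by metis
  qed
  then obtain i where i: "\<Psi> (shift k) = shift i" by (auto simp: g_def)
  \<comment> \<open>For \<open>i = 0\<close> the element \<open>\<Psi> (shift k)\<close> would be
    idempotent, hence also \<open>shift k\<close>, which is impossible for
    \<open>k > 0\<close>.\<close>
  have "i \<noteq> 0"
  proof
    assume "i = 0"
    then have "\<Psi> (shift k \<circ> shift k) = \<Psi> (shift k)"
      using hom'[OF shift_stab shift_stab] i by simp
    then have "shift k \<circ> shift k = (shift k :: (int \<Rightarrow> bool option) \<Rightarrow> _)"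
      using \<Phi>\<Psi> shift_stab stab_comp by metis
    then have "shift (k + k) = (shift k :: (int \<Rightarrow> bool option) \<Rightarrow> _)"
      by (simp add: fun_eq_iff)
    then have "k + k = k" by (rule shift_inj) (simp add: card3)
    then show False using k(1) by simp
  qed
  have "\<Phi> (shift i) = shift k" using \<Phi>\<Psi>[OF shift_stab, of k] i by simp
  then have "CARD(bool) ^ nat \<bar>i\<bar> \<le> CARD(bool option) ^ nat \<bar>k\<bar>"
    using growth_le[of \<Phi> i k, OF _ maps hom bij_betw_imp_inj_on[OF bij]] \<open>i \<noteq> 0\<close> k(1) by simp
  moreover have "CARD(bool option) ^ nat \<bar>k\<bar> \<le> CARD(bool) ^ nat \<bar>i\<bar>"
    using growth_le[of \<Psi> k i, OF _ maps' hom' bij_betw_imp_inj_on[OF bij']] \<open>i \<noteq> 0\<close> k(1) i card3 by simp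
  ultimately have "(2::nat) ^ nat \<bar>i\<bar> = 3 ^ nat \<bar>k\<bar>" using card3 by simp
  moreover have "even ((2::nat) ^ nat \<bar>i\<bar>)" using \<open>i \<noteq> 0\<close> by simp
  moreover have "odd ((3::nat) ^ nat \<bar>k\<bar>)" by simp
  ultimately show False by metis
qed

theorem corollary4:
  fixes A :: "'a set" and B :: "'b set"
  assumes "card A = 2" and "card B = 3"
  shows "\<not> (stab_aut_group (full_shift A) left_shift \<cong> stab_aut_group (full_shift B) left_shift)"
proof
  assume iso: "stab_aut_group (full_shift A) left_shift \<cong> stab_aut_group (full_shift B) left_shift"
  have "finite A" "finite B" using assms by (auto intro: card_ge_0_finite)
  moreover have "card (UNIV :: bool option set) = 3" by (simp add: UNIV_option_conv card_image)
  ultimately obtain a b where "bij_betw a (UNIV :: bool set) A" "bij_betw b B (UNIV :: bool option set)"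
    using assms finite_same_card_bij[of "UNIV :: bool set" A] finite_same_card_bij[of B "UNIV :: bool option set"]
    by auto
  then show False
    using iso_trans[OF iso_trans[OF full_shift_iso iso] full_shift_iso] not_iso_bool_option by blast
qed

end
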